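(* Let $S$ be a subset of a real vector space with $0\in S$ and $-S=S$, and let $g$ and $g_i$ ($1\le i\le j$) be odd functions from $S$ into itself (i.e. $g(-x)=-g(x)$) such that, for every positive integer $n$, the equations $g^n(x)=-x$ and $g_i^n(x)=-x$ have finitely many solutions in $S$. Then: (a) For any fixed odd integer $k>0$, letting $\psi_k(n)=\psi_g(kn)$, we have $\Phi_2(\psi_k,n)\equiv 0\pmod{2n}$ for all positive integers $n$. (b) Letting $(\prod_{i=1}^j\psi_{g_i})(n)=\prod_{i=1}^j\psi_{g_i}(n)$, we have $\Phi_2(\prod_{i=1}^j\psi_{g_i},n)\equiv 0\pmod{2n}$ for all positive integers $n$.
   Context: $g^n$ denotes the $n$-th iterate of $g$. For an odd map $h:S\to S$, $\psi_h(n)$ denotes the number of distinct solutions $x\in S$ of $h^n(x)=-x$. For an integer-valued function $\phi$ on the positive integers: if $n=2^{k_0}p_1^{k_1}\cdots p_r^{k_r}$ with distinct odd primes $p_i$, $k_0\ge 0$, $r\ge1$, $k_i\ge1$, then $\Phi_2(\phi,n)=\phi(n)-\sum_i\phi(n/p_i)+\sum_{i_1<i_2}\phi(n/(p_{i_1}p_{i_2}))-\cdots+(-1)^r\phi(n/(p_1\cdots p_r))$; if $n=2^k$ with $k\ge0$, then $\Phi_2(\phi,n)=\phi(n)-1$. *)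

theory Defs
  imports Complex_Main "HOL-Computational_Algebra.Primes" "HOL-Number_Theory.Cong"
begin

definition odd_self_map :: "'a::real_vector set \<Rightarrow> ('a \<Rightarrow> 'a) \<Rightarrow> bool" where
  "odd_self_map S h \<longleftrightarrow> (\<forall>x\<in>S. h x \<in> S \<and> h (- x) = - h x)"

definition antiper_sols :: "'a::real_vector set \<Rightarrow> ('a \<Rightarrow> 'a) \<Rightarrow> nat \<Rightarrow> 'a set" where
  "antiper_sols S h n = {x \<in> S. (h ^^ n) x = - x}"

definition psi :: "'a::real_vector set \<Rightarrow> ('a \<Rightarrow> 'a) \<Rightarrow> nat \<Rightarrow> int" where
  "psi S h n = int (card (antiper_sols S h n))"

text \<open>
  The alternating sum \<open>\<phi>(n) - \<Sum>\<^sub>i \<phi>(n/p\<^sub>i) + \<Sum> \<phi>(n/(p\<^sub>i p\<^sub>j)) - \<dots>\<close> is indexed by the sets \<open>A\<close> of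
  odd prime divisors of \<open>n\<close>; the empty set gives the term \<open>\<phi>(n)\<close>. Only \<open>n > 0\<close> is meaningful.
\<close>

definition Phi2 :: "(nat \<Rightarrow> int) \<Rightarrow> nat \<Rightarrow> int" where
  "Phi2 \<phi> n =
     (if \<exists>k. n = 2 ^ k then \<phi> n - 1
      else \<Sum>A\<in>Pow {p \<in> prime_factors n. odd p}. (- 1) ^ card A * \<phi> (n div \<Prod>A))"

end

theory Submission
  imports Defs "HOL-Combinatorics.Orbits"
begin

text \<open>
  If \<open>h\<^sup>n x = - x\<close> with \<open>x \<noteq> 0\<close>, then the period of \<open>x\<close> divides \<open>2n\<close> but not \<open>n\<close>; so it is even,
  say \<open>2m\<close>, and \<open>h\<^sup>l x = - x\<close> holds exactly when \<open>l\<close> is an odd multiple of \<open>m\<close>. The solution \<open>0\<close>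
  contributes \<open>1\<close> to every value of \<open>\<psi>\<^sub>h\<close>, and \<open>\<Phi>\<^sub>2(\<phi>, n)\<close> is the alternating sum of the values
  of \<open>\<phi> - 1\<close> whether or not \<open>n\<close> is a power of \<open>2\<close>; by inclusion--exclusion it therefore counts
  the points with \<open>m = n\<close>, and these fall into orbits of size \<open>2n\<close>. Part (a) is this statement for
  \<open>g\<^sup>k\<close>, part (b) for the product map on \<open>S\<^sup>j\<close>. The product does not live in the given vector space,
  but only the involution \<open>x \<mapsto> - x\<close> and its unique fixed point matter.
\<close>

subsection \<open>Periods and orbits\<close>

lemma card_orbit_eq_funpow_dist1:
  assumes "x \<in> orbit f x"
  shows "card (orbit f x) = funpow_dist1 f x x"
  using orbit_conv_funpow_dist1[OF assms] card_image[OF inj_on_funpow_dist1[OF assms]] by simp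

lemma funpow_eq_iff_cong_card_orbit:
  assumes "x \<in> orbit f x"
  shows "(f ^^ k) x = (f ^^ l) x \<longleftrightarrow> [k = l] (mod card (orbit f x))"
proof -
  define p where "p = card (orbit f x)"
  have p: "p = funpow_dist1 f x x"
    using card_orbit_eq_funpow_dist1[OF assms] by (simp only: p_def)
  then have "(f ^^ p) x = x"
    using funpow_dist1_prop[OF assms] by (simp only:)
  then have mod: "(f ^^ i) x = (f ^^ (i mod p)) x" for i
    by (rule funpow_mod_eq[symmetric])
  have "p > 0"
    by (simp add: p)
  have "inj_on (\<lambda>i. (f ^^ i) x) {0..<p}"
    using inj_on_funpow_dist1[OF assms] by (simp only: p)
  then have "(f ^^ (k mod p)) x = (f ^^ (l mod p)) x \<longleftrightarrow> k mod p = l mod p"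
    using \<open>p > 0\<close> by (intro inj_on_eq_iff) auto
  then show ?thesis
    by (simp only: mod[of k] mod[of l] cong_def p_def)
qed

lemma funpow_eq_self_iff_card_orbit_dvd:
  assumes "x \<in> orbit f x"
  shows "(f ^^ l) x = x \<longleftrightarrow> card (orbit f x) dvd l"
  using funpow_eq_iff_cong_card_orbit[OF assms, of l 0] by (simp add: cong_0_iff)

lemma dvd_card_if_dvd_card_orbits:
  assumes "finite C" and closed: "\<And>x. x \<in> C \<Longrightarrow> f x \<in> C"
    and recurrent: "\<And>x. x \<in> C \<Longrightarrow> x \<in> orbit f x"
    and dvd: "\<And>x. x \<in> C \<Longrightarrow> k dvd card (orbit f x)"
  shows "k dvd card C"
proof -
  have "orbit f x \<subseteq> C" if "x \<in> C" for x
  proof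
    show "y \<in> C" if "y \<in> orbit f x" for y
      using that by induction (use \<open>x \<in> C\<close> closed in auto)
  qed
  then have Union: "\<Union>(orbit f ` C) = C"
    using recurrent by blast
  have cyclic: "cyclic_on f (orbit f x)" if "x \<in> C" for x
    using recurrent[OF that] by (rule cyclic_on_singleI) simp
  have "orbit f x = orbit f y" if "x \<in> C" "y \<in> C" "w \<in> orbit f x" "w \<in> orbit f y" for x y w
    using cyclic that orbit_cyclic_eq3 by metis
  then have "\<forall>c\<in>orbit f ` C. \<forall>d\<in>orbit f ` C. c \<noteq> d \<longrightarrow> c \<inter> d = {}"
    by blast
  then have "k dvd card (\<Union>(orbit f ` C))"
    using \<open>finite C\<close> dvd by (intro dvd_partition) (auto simp: Union)
  then show ?thesis
    by (simp only: Union)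
qed

subsection \<open>Odd multiples and inclusion--exclusion\<close>

definition odd_multiple :: "nat \<Rightarrow> nat \<Rightarrow> bool" where
  "odd_multiple m n \<longleftrightarrow> (\<exists>c. odd c \<and> n = m * c)"

definition odd_prime_factors :: "nat \<Rightarrow> nat set" where
  "odd_prime_factors n = {p \<in> prime_factors n. odd p}"

lemma odd_multiple_trans: "odd_multiple l m \<Longrightarrow> odd_multiple m n \<Longrightarrow> odd_multiple l n"
  unfolding odd_multiple_def by (metis even_mult_iff mult.assoc)

lemma odd_multiple_iff_cong:
  assumes "m > 0"
  shows "odd_multiple m n \<longleftrightarrow> [n = m] (mod 2 * m)"
proof
  assume "odd_multiple m n"
  then obtain c where "odd c" "n = m * c"
    unfolding odd_multiple_def by blast
  then obtain b where "n = m * (2 * b + 1)"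
    by (metis oddE)
  then have "n = 2 * m * b + m"
    by (simp add: algebra_simps)
  then show "[n = m] (mod 2 * m)"
    by (simp add: cong_def)
next
  assume "[n = m] (mod 2 * m)"
  then have "n mod (2 * m) = m"
    using assms by (simp add: cong_def)
  then have "n = m * (2 * (n div (2 * m)) + 1)"
    using mult_div_mod_eq[of "2 * m" n] by (simp add: algebra_simps)
  then show "odd_multiple m n"
    unfolding odd_multiple_def by (intro exI[of _ "2 * (n div (2 * m)) + 1"]) simp
qed

lemma finite_odd_prime_factors [simp]: "finite (odd_prime_factors n)"
  by (simp add: odd_prime_factors_def)

lemma odd_prime_factors_eq_empty_iff:
  assumes "n > 0"
  shows "odd_prime_factors n = {} \<longleftrightarrow> (\<exists>k. n = 2 ^ k)"
proof
  assume empty: "odd_prime_factors n = {}"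
  obtain k b where n: "n = 2 ^ k * b" "odd b"
    using assms by (metis multiplicity_decompose' neq0_conv odd_one)
  have "b = 1"
  proof (rule ccontr)
    assume "b \<noteq> 1"
    then obtain p where "prime p" "p dvd b"
      using prime_factor_nat by blast
    moreover from this have "odd p"
      using \<open>odd b\<close> dvd_trans by blast
    ultimately have "p \<in> odd_prime_factors n"
      using assms n by (simp add: odd_prime_factors_def prime_factors_dvd)
    with empty show False by simp
  qed
  with n show "\<exists>k. n = 2 ^ k" by auto
next
  assume "\<exists>k. n = 2 ^ k"
  moreover have "even p" if "prime p" "p dvd 2 ^ k" for p k :: nat
    using prime_dvd_power[OF that] primes_dvd_imp_eq[OF that(1) two_is_prime_nat] by simp
  ultimately show "odd_prime_factors n = {}"
    by (auto simp: odd_prime_factors_def prime_factors_dvd)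
qed

lemma sum_Pow_alternating:
  assumes "finite P"
  shows "(\<Sum>A\<in>Pow P. (- 1) ^ card A) = (of_bool (P = {}) :: 'b::comm_ring_1)"
  using prod_diff_conv_sum[OF assms, of "\<lambda>_. 1 :: 'b" "\<lambda>_. 1", symmetric] assms
  by (simp add: power_0_left)

lemma Phi2_eq_sum_Pow:
  assumes "n > 0"
  shows "Phi2 \<phi> n = (\<Sum>A\<in>Pow (odd_prime_factors n). (- 1) ^ card A * (\<phi> (n div \<Prod>A) - 1))"
proof (cases "odd_prime_factors n = {}")
  case True
  then show ?thesis
    using odd_prime_factors_eq_empty_iff[OF assms] by (auto simp: Phi2_def)
next
  case False
  then show ?thesis
    using odd_prime_factors_eq_empty_iff[OF assms]
    by (auto simp: Phi2_def odd_prime_factors_def[symmetric] right_diff_distrib sum_subtractf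
        sum_Pow_alternating)
qed

lemma prod_dvd_iff_if_pairwise_coprime:
  fixes f :: "'i \<Rightarrow> nat"
  assumes "finite A" "\<And>i j. i \<in> A \<Longrightarrow> j \<in> A \<Longrightarrow> i \<noteq> j \<Longrightarrow> coprime (f i) (f j)"
  shows "prod f A dvd c \<longleftrightarrow> (\<forall>i\<in>A. f i dvd c)"
proof
  assume "\<forall>i\<in>A. f i dvd c"
  then have "[c = 0] (mod prod f A)"
    using assms by (intro coprime_cong_prod_nat) (auto simp: cong_0_iff)
  then show "prod f A dvd c"
    by (simp add: cong_0_iff)
qed (use assms in \<open>auto intro: dvd_trans[OF dvd_prodI]\<close>)

lemma odd_prod_odd_prime_factors:
  assumes "A \<subseteq> odd_prime_factors n"
  shows "odd (\<Prod>A)"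
  using assms finite_subset[OF assms] by (auto simp: odd_prime_factors_def even_prod_iff)

lemma prod_odd_prime_factors_dvd_iff:
  assumes "A \<subseteq> odd_prime_factors n" "c > 0"
  shows "\<Prod>A dvd c \<longleftrightarrow> A \<subseteq> odd_prime_factors c"
proof -
  have "\<Prod>A dvd c \<longleftrightarrow> (\<forall>p\<in>A. p dvd c)"
    using assms finite_subset[OF assms(1)]
    by (intro prod_dvd_iff_if_pairwise_coprime)
      (auto simp: odd_prime_factors_def intro!: primes_coprime)
  also have "\<dots> \<longleftrightarrow> A \<subseteq> odd_prime_factors c"
    using assms by (auto simp: odd_prime_factors_def prime_factors_dvd)
  finally show ?thesis .
qed

lemma odd_multiple_div_prod_odd_prime_factors:
  assumes "n > 0" "A \<subseteq> odd_prime_factors n"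
  shows "odd_multiple (n div \<Prod>A) n"
  using odd_prod_odd_prime_factors prod_odd_prime_factors_dvd_iff assms
  unfolding odd_multiple_def by (metis dvd_div_mult_self)

lemma odd_multiple_div_iff:
  assumes "m > 0" "odd c" "odd d" "d dvd m * c"
  shows "odd_multiple m (m * c div d) \<longleftrightarrow> d dvd c"
proof
  assume "odd_multiple m (m * c div d)"
  then obtain b where "m * c div d = m * b"
    unfolding odd_multiple_def by blast
  then have "m * c = m * (b * d)"
    using \<open>d dvd m * c\<close> by (metis dvd_div_mult_self mult.assoc)
  then show "d dvd c"
    using \<open>m > 0\<close> by simp
next
  assume "d dvd c"
  then obtain b where "c = d * b" ..
  then show "odd_multiple m (m * c div d)"
    unfolding odd_multiple_def using \<open>odd c\<close> by (intro exI[of _ b]) (auto simp: odd_pos)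
qed

lemma sum_Pow_odd_multiple:
  assumes "n > 0" "odd_multiple m n"
  shows "(\<Sum>A\<in>Pow (odd_prime_factors n). (- 1) ^ card A * of_bool (odd_multiple m (n div \<Prod>A))) =
    (of_bool (m = n) :: 'b::comm_ring_1)"
proof -
  obtain c where c: "odd c" "n = m * c"
    using assms unfolding odd_multiple_def by blast
  then have pos: "m > 0" "c > 0"
    using assms by auto
  have sub: "odd_prime_factors c \<subseteq> odd_prime_factors n"
    using pos c by (auto simp: odd_prime_factors_def prime_factors_dvd)
  have iff: "odd_multiple m (n div \<Prod>A) \<longleftrightarrow> A \<subseteq> odd_prime_factors c"
    if A: "A \<subseteq> odd_prime_factors n" for A
  proof -
    have "\<Prod>A dvd m * c"
      using A \<open>n > 0\<close> c(2) prod_odd_prime_factors_dvd_iff by blast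
    then have "odd_multiple m (n div \<Prod>A) \<longleftrightarrow> \<Prod>A dvd c"
      using odd_multiple_div_iff pos c odd_prod_odd_prime_factors[OF A] by simp
    also have "\<dots> \<longleftrightarrow> A \<subseteq> odd_prime_factors c"
      using A pos by (intro prod_odd_prime_factors_dvd_iff)
    finally show ?thesis .
  qed
  have "(\<Sum>A\<in>Pow (odd_prime_factors n). (- 1) ^ card A * of_bool (odd_multiple m (n div \<Prod>A))) =
      (\<Sum>A\<in>Pow (odd_prime_factors c). (- 1) ^ card A :: 'b)"
    using sub by (intro sum.mono_neutral_cong_right) (auto simp: iff)
  also have "\<dots> = of_bool (odd_prime_factors c = {})"
    by (rule sum_Pow_alternating) simp
  also have "odd_prime_factors c = {} \<longleftrightarrow> c = 1"
    using odd_prime_factors_eq_empty_iff[OF \<open>c > 0\<close>] \<open>odd c\<close>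
    by (metis even_numeral even_power neq0_conv power_0)
  also have "\<dots> \<longleftrightarrow> m = n"
    using c pos by auto
  finally show ?thesis .
qed

lemma Phi2_eq_card_odd_multiple:
  assumes "n > 0" "finite T" and T: "\<And>x. x \<in> T \<Longrightarrow> odd_multiple (\<mu> x) n"
    and \<phi>: "\<And>d. odd_multiple d n \<Longrightarrow> \<phi> d = 1 + int (card {x \<in> T. odd_multiple (\<mu> x) d})"
  shows "Phi2 \<phi> n = int (card {x \<in> T. \<mu> x = n})"
proof -
  let ?\<P> = "Pow (odd_prime_factors n)"
  have \<phi>_div: "\<phi> (n div \<Prod>A) - 1 = (\<Sum>x\<in>T. of_bool (odd_multiple (\<mu> x) (n div \<Prod>A)))"
    if "A \<in> ?\<P>" for A
    using \<phi>[of "n div \<Prod>A"] odd_multiple_div_prod_odd_prime_factors[of n A] that assms(1,2)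
    by (simp add: Int_def)
  have "Phi2 \<phi> n =
      (\<Sum>A\<in>?\<P>. \<Sum>x\<in>T. (- 1) ^ card A * of_bool (odd_multiple (\<mu> x) (n div \<Prod>A)))"
    using \<phi>_div by (simp only: Phi2_eq_sum_Pow[OF \<open>n > 0\<close>] sum_distrib_left cong: sum.cong)
  also have "\<dots> =
      (\<Sum>x\<in>T. \<Sum>A\<in>?\<P>. (- 1) ^ card A * of_bool (odd_multiple (\<mu> x) (n div \<Prod>A)))"
    by (rule sum.swap)
  also have "\<dots> = (\<Sum>x\<in>T. of_bool (\<mu> x = n))"
    using T by (intro sum.cong sum_Pow_odd_multiple \<open>n > 0\<close>) auto
  also have "\<dots> = int (card {x \<in> T. \<mu> x = n})"
    using \<open>finite T\<close> by (simp add: Int_def)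
  finally show ?thesis .
qed

subsection \<open>Maps commuting with an involution\<close>

definition antiperiodic_points :: "'b set \<Rightarrow> ('b \<Rightarrow> 'b) \<Rightarrow> ('b \<Rightarrow> 'b) \<Rightarrow> nat \<Rightarrow> 'b set" where
  "antiperiodic_points X \<sigma> h n = {x \<in> X. (h ^^ n) x = \<sigma> x}"

locale odd_system =
  fixes X :: "'b set" and \<sigma> h :: "'b \<Rightarrow> 'b" and z :: 'b
  assumes map_closed: "x \<in> X \<Longrightarrow> h x \<in> X"
    and neg_neg: "x \<in> X \<Longrightarrow> \<sigma> (\<sigma> x) = x"
    and map_neg: "x \<in> X \<Longrightarrow> h (\<sigma> x) = \<sigma> (h x)"
    and zero_closed: "z \<in> X"
    and neg_eq_self_iff: "x \<in> X \<Longrightarrow> \<sigma> x = x \<longleftrightarrow> x = z"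
begin

abbreviation points :: "nat \<Rightarrow> 'b set" where
  "points \<equiv> antiperiodic_points X \<sigma> h"

definition antiperiod :: "'b \<Rightarrow> nat" where
  "antiperiod x = card (orbit h x) div 2"

lemma map_zero: "h z = z"
  using map_closed map_neg neg_eq_self_iff zero_closed by metis

lemma zero_in_points: "z \<in> points n"
proof -
  have "(h ^^ n) z = z" by (induction n) (auto simp: map_zero)
  then show ?thesis
    using zero_closed neg_eq_self_iff[of z] by (simp add: antiperiodic_points_def)
qed

lemma funpow_neg:
  assumes "x \<in> X"
  shows "(h ^^ n) (\<sigma> x) = \<sigma> ((h ^^ n) x)"
proof -
  have "(h ^^ n) x \<in> X" for n by (induction n) (auto simp: assms map_closed)
  then show ?thesis by (induction n) (auto simp: map_neg)
qed

lemma points_invariant: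
  assumes "x \<in> points n"
  shows "h x \<in> points n"
  using assms by (simp add: antiperiodic_points_def map_closed map_neg funpow_swap1[symmetric])

lemma funpow_double_points:
  assumes "x \<in> points n"
  shows "(h ^^ (2 * n)) x = x"
  using assms by (simp add: antiperiodic_points_def mult_2 funpow_add funpow_neg neg_neg)

lemma points_self_in_orbit:
  assumes "x \<in> points n" "n > 0"
  shows "x \<in> orbit h x"
proof -
  have "\<exists>l>0. (h ^^ l) x = x"
    using funpow_double_points[OF assms(1)] assms(2) by (intro exI[of _ "2 * n"]) simp
  then show ?thesis by (metis (mono_tags, lifting) mem_Collect_eq orbit_altdef)
qed

lemma card_orbit_dvd_double:
  assumes "x \<in> points n" "n > 0"
  shows "card (orbit h x) dvd 2 * n"
  using funpow_double_points[OF assms(1)]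
    funpow_eq_self_iff_card_orbit_dvd[OF points_self_in_orbit[OF assms]] by blast

lemma not_card_orbit_dvd:
  assumes "x \<in> points n" "n > 0" "x \<noteq> z"
  shows "\<not> card (orbit h x) dvd n"
  using funpow_eq_self_iff_card_orbit_dvd[OF points_self_in_orbit[OF assms(1,2)], of n] assms
    neg_eq_self_iff by (simp add: antiperiodic_points_def)

lemma card_orbit_eq_double_antiperiod:
  assumes "x \<in> points n" "n > 0" "x \<noteq> z"
  shows "card (orbit h x) = 2 * antiperiod x"
proof -
  have "even (card (orbit h x))"
    using card_orbit_dvd_double[OF assms(1,2)] not_card_orbit_dvd[OF assms]
    by (meson coprime_dvd_mult_right_iff coprime_right_2_iff_odd)
  then show ?thesis by (simp add: antiperiod_def)
qed

lemma odd_multiple_antiperiod: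
  assumes "x \<in> points n" "n > 0" "x \<noteq> z"
  shows "odd_multiple (antiperiod x) n"
proof -
  note double = card_orbit_eq_double_antiperiod[OF assms]
  have "antiperiod x dvd n"
    using card_orbit_dvd_double[OF assms(1,2)] by (simp add: double)
  then obtain c where c: "n = antiperiod x * c" ..
  then have "odd c"
    using not_card_orbit_dvd[OF assms] by (auto simp: double)
  with c show ?thesis
    unfolding odd_multiple_def by blast
qed

lemma in_points_iff_odd_multiple:
  assumes "x \<in> points n" "n > 0" "x \<noteq> z"
  shows "x \<in> points l \<longleftrightarrow> odd_multiple (antiperiod x) l"
proof -
  have pos: "antiperiod x > 0"
    using odd_multiple_antiperiod[OF assms] \<open>n > 0\<close> by (auto simp: odd_multiple_def)
  have "x \<in> points l \<longleftrightarrow> (h ^^ l) x = (h ^^ n) x"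
    using assms by (simp add: antiperiodic_points_def)
  also have "\<dots> \<longleftrightarrow> [l = n] (mod 2 * antiperiod x)"
    using funpow_eq_iff_cong_card_orbit[OF points_self_in_orbit[OF assms(1,2)]]
    by (simp only: card_orbit_eq_double_antiperiod[OF assms])
  also have "\<dots> \<longleftrightarrow> [l = antiperiod x] (mod 2 * antiperiod x)"
    using odd_multiple_antiperiod[OF assms] by (simp add: odd_multiple_iff_cong[OF pos] cong_def)
  also have "\<dots> \<longleftrightarrow> odd_multiple (antiperiod x) l"
    by (rule odd_multiple_iff_cong[OF pos, symmetric])
  finally show ?thesis .
qed

lemma points_subset_if_odd_multiple:
  assumes "d > 0" "odd_multiple d n"
  shows "points d \<subseteq> points n"
proof
  fix x assume x: "x \<in> points d"
  show "x \<in> points n"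
  proof (cases "x = z")
    case False
    then have "odd_multiple (antiperiod x) n"
      using odd_multiple_antiperiod[OF x \<open>d > 0\<close>] assms(2) by (blast intro: odd_multiple_trans)
    then show ?thesis
      using in_points_iff_odd_multiple[OF x \<open>d > 0\<close> False] by simp
  qed (simp add: zero_in_points)
qed

lemma Phi2_card_points_eq:
  assumes "n > 0" "finite (points n)"
  shows "Phi2 (\<lambda>m. int (card (points m))) n = int (card {x \<in> points n - {z}. antiperiod x = n})"
proof (rule Phi2_eq_card_odd_multiple)
  show "odd_multiple (antiperiod x) n" if "x \<in> points n - {z}" for x
    using odd_multiple_antiperiod that \<open>n > 0\<close> by simp
next
  fix d assume d: "odd_multiple d n"
  then have "d > 0"
    using \<open>n > 0\<close> by (auto simp: odd_multiple_def)
  then have sub: "points d \<subseteq> points n"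
    using d by (rule points_subset_if_odd_multiple)
  then have "{x \<in> points n - {z}. odd_multiple (antiperiod x) d} = points d - {z}"
    using in_points_iff_odd_multiple[OF _ \<open>n > 0\<close>] by blast
  moreover have "finite (points d)"
    using sub assms(2) by (rule finite_subset)
  then have "card (points d) = Suc (card (points d - {z}))"
    using zero_in_points by (intro card.remove)
  ultimately show "int (card (points d)) =
      1 + int (card {x \<in> points n - {z}. odd_multiple (antiperiod x) d})"
    by simp
qed (use assms in auto)

lemma double_dvd_card_points_antiperiod:
  assumes "n > 0" "finite (points n)"
  shows "2 * n dvd card {x \<in> points n - {z}. antiperiod x = n}"
proof (rule dvd_card_if_dvd_card_orbits)
  fix x assume x: "x \<in> {x \<in> points n - {z}. antiperiod x = n}"
  then show recurrent: "x \<in> orbit h x"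
    using points_self_in_orbit \<open>n > 0\<close> by blast
  show "2 * n dvd card (orbit h x)"
    using card_orbit_eq_double_antiperiod[of x n] x \<open>n > 0\<close> by simp
  have "orbit h (h x) = orbit h x"
    using recurrent by (rule self_in_orbit_step)
  moreover from this have "h x \<noteq> z"
    using orbit_eq_singleton_iff[of h z] map_zero recurrent x by auto
  ultimately show "h x \<in> {x \<in> points n - {z}. antiperiod x = n}"
    using points_invariant x by (auto simp: antiperiod_def)
qed (use assms in auto)

theorem Phi2_card_points_cong:
  assumes "n > 0" "finite (points n)"
  shows "[Phi2 (\<lambda>m. int (card (points m))) n = 0] (mod int (2 * n))"
  unfolding Phi2_card_points_eq[OF assms] cong_0_iff
  using double_dvd_card_points_antiperiod[OF assms] by (simp only: of_nat_dvd_iff)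

end

subsection \<open>Products of odd systems\<close>

definition componentwise :: "'i set \<Rightarrow> ('i \<Rightarrow> 'b \<Rightarrow> 'c) \<Rightarrow> ('i \<Rightarrow> 'b) \<Rightarrow> 'i \<Rightarrow> 'c" where
  "componentwise I f x = (\<lambda>i\<in>I. f i (x i))"

lemma componentwise_apply [simp]: "i \<in> I \<Longrightarrow> componentwise I f x i = f i (x i)"
  by (simp add: componentwise_def)

lemma componentwise_extensional [simp]: "componentwise I f x \<in> extensional I"
  by (simp add: componentwise_def)

lemma componentwise_eq_iff:
  assumes "y \<in> extensional I"
  shows "componentwise I f x = y \<longleftrightarrow> (\<forall>i\<in>I. f i (x i) = y i)"
proof
  assume "\<forall>i\<in>I. f i (x i) = y i"
  then show "componentwise I f x = y"
    using assms by (intro extensionalityI[of _ I]) auto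
qed auto

lemma funpow_componentwise:
  fixes f :: "'i \<Rightarrow> 'b \<Rightarrow> 'b"
  assumes "x \<in> extensional I"
  shows "(componentwise I f ^^ n) x = componentwise I (\<lambda>i. f i ^^ n) x"
proof (induction n)
  case 0
  have "componentwise I (\<lambda>_ y. y) x = x"
    using assms by (simp add: componentwise_eq_iff)
  then show ?case by simp
qed (simp add: componentwise_eq_iff)

lemma antiperiodic_points_PiE:
  "antiperiodic_points (Pi\<^sub>E I X) (componentwise I \<sigma>) (componentwise I h) n =
    (\<Pi>\<^sub>E i\<in>I. antiperiodic_points (X i) (\<sigma> i) (h i) n)"
  by (auto simp: antiperiodic_points_def PiE_iff funpow_componentwise componentwise_eq_iff
      intro: extensional_arb)

lemma odd_system_PiE:
  assumes "\<And>i. i \<in> I \<Longrightarrow> odd_system (X i) (\<sigma> i) (h i) (z i)"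
  shows "odd_system (Pi\<^sub>E I X) (componentwise I \<sigma>) (componentwise I h) (restrict z I)"
proof
  note component = assms[THEN odd_system.map_closed] assms[THEN odd_system.neg_neg]
    assms[THEN odd_system.map_neg] assms[THEN odd_system.zero_closed]
    assms[THEN odd_system.neg_eq_self_iff]
  show "restrict z I \<in> Pi\<^sub>E I X"
    by (simp add: PiE_iff component)
  fix x assume x: "x \<in> Pi\<^sub>E I X"
  then show "componentwise I h x \<in> Pi\<^sub>E I X"
    and "componentwise I \<sigma> (componentwise I \<sigma> x) = x"
    and "componentwise I h (componentwise I \<sigma> x) = componentwise I \<sigma> (componentwise I h x)"
    by (simp_all add: PiE_iff componentwise_eq_iff component)
  have "componentwise I \<sigma> x = x \<longleftrightarrow> (\<forall>i\<in>I. x i = z i)"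
    using x by (simp add: PiE_iff componentwise_eq_iff component)
  also have "\<dots> \<longleftrightarrow> x = restrict z I"
    using x by (auto simp: PiE_iff intro: extensionalityI)
  finally show "componentwise I \<sigma> x = x \<longleftrightarrow> x = restrict z I" .
qed

subsection \<open>Odd maps on a symmetric set\<close>

lemma antiper_sols_eq_antiperiodic_points: "antiper_sols S h = antiperiodic_points S uminus h"
  by (simp add: antiper_sols_def antiperiodic_points_def fun_eq_iff)

lemma uminus_eq_self_iff:
  fixes v :: "'a::real_vector"
  shows "- v = v \<longleftrightarrow> v = 0"
proof
  assume "- v = v"
  then have "2 *\<^sub>R v = 0" by (metis add.left_inverse scaleR_2)
  then show "v = 0" by simp
qed simp

lemma odd_system_uminus:
  assumes "0 \<in> S" "odd_self_map S h"
  shows "odd_system S uminus h 0"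
  using assms by unfold_locales (auto simp: odd_self_map_def uminus_eq_self_iff)

lemma Phi2_psi_cong:
  assumes "0 \<in> S" "odd_self_map S h" "n > 0" "finite (antiper_sols S h n)"
  shows "[Phi2 (psi S h) n = 0] (mod int (2 * n))"
  using odd_system.Phi2_card_points_cong[OF odd_system_uminus] assms
  by (simp add: psi_def[abs_def] antiper_sols_eq_antiperiodic_points)

lemma Phi2_prod_psi_cong:
  assumes "0 \<in> S" "finite I" "n > 0"
    and "\<And>i. i \<in> I \<Longrightarrow> odd_self_map S (f i)"
    and "\<And>i. i \<in> I \<Longrightarrow> finite (antiper_sols S (f i) n)"
  shows "[Phi2 (\<lambda>m. \<Prod>i\<in>I. psi S (f i) m) n = 0] (mod int (2 * n))"
proof -
  interpret odd_system "\<Pi>\<^sub>E i\<in>I. S" "componentwise I (\<lambda>_. uminus)" "componentwise I f" "\<lambda>i\<in>I. 0"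
    using assms by (intro odd_system_PiE odd_system_uminus)
  have points: "points m = (\<Pi>\<^sub>E i\<in>I. antiper_sols S (f i) m)" for m
    by (simp only: antiperiodic_points_PiE antiper_sols_eq_antiperiodic_points)
  have "finite (points n)"
    using assms by (simp add: points finite_PiE)
  then show ?thesis
    using Phi2_card_points_cong[of n] assms by (simp add: points card_PiE psi_def)
qed

lemma odd_self_map_funpow:
  assumes "odd_self_map S h"
  shows "odd_self_map S (h ^^ k)"
proof -
  have "(h ^^ k) x \<in> S \<and> (h ^^ k) (- x) = - (h ^^ k) x" if "x \<in> S" for x
    using that assms by (induction k) (auto simp: odd_self_map_def)
  then show ?thesis by (simp add: odd_self_map_def)
qed

lemma antiper_sols_funpow: "antiper_sols S (h ^^ k) n = antiper_sols S h (k * n)"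
  by (simp add: antiper_sols_def funpow_mult)

theorem theorem3:
  fixes S :: "'a::real_vector set"
    and g :: "'a \<Rightarrow> 'a"
    and gs :: "nat \<Rightarrow> 'a \<Rightarrow> 'a"
    and j :: nat
  assumes zero: "0 \<in> S"
    and sym: "uminus ` S = S"
    and g_odd: "odd_self_map S g"
    and gs_odd: "\<And>i. i \<in> {1..j} \<Longrightarrow> odd_self_map S (gs i)"
    and g_fin: "\<And>n. n > 0 \<Longrightarrow> finite (antiper_sols S g n)"
    and gs_fin: "\<And>i n. i \<in> {1..j} \<Longrightarrow> n > 0 \<Longrightarrow> finite (antiper_sols S (gs i) n)"
  shows "(\<forall>k::nat. odd k \<and> k > 0 \<longrightarrow>
            (\<forall>n>0. [Phi2 (\<lambda>m. psi S g (k * m)) n = 0] (mod int (2 * n)))) \<and>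
         (\<forall>n>0. [Phi2 (\<lambda>m. \<Prod>i=1..j. psi S (gs i) m) n = 0] (mod int (2 * n)))"
proof (intro conjI allI impI)
  fix k n :: nat
  assume k: "odd k \<and> k > 0" and n: "n > 0"
  have "finite (antiper_sols S (g ^^ k) n)"
    using g_fin k n by (simp add: antiper_sols_funpow)
  then have "[Phi2 (psi S (g ^^ k)) n = 0] (mod int (2 * n))"
    using n by (intro Phi2_psi_cong[OF zero] odd_self_map_funpow[OF g_odd])
  moreover have "psi S (g ^^ k) = (\<lambda>m. psi S g (k * m))"
    by (simp add: psi_def antiper_sols_funpow fun_eq_iff)
  ultimately show "[Phi2 (\<lambda>m. psi S g (k * m)) n = 0] (mod int (2 * n))"
    by simp
next
  fix n :: nat
  assume "n > 0"
  then show "[Phi2 (\<lambda>m. \<Prod>i=1..j. psi S (gs i) m) n = 0] (mod int (2 * n))"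
    using zero gs_odd gs_fin by (intro Phi2_prod_psi_cong) auto
qed

end
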